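(* Let $\mathbf p=(p_{ij})$ be an $N\times M$ matrix with strictly positive entries and $\mathbf q=(q_{ij})$ an $N\times M$ matrix with non-negative entries such that every row and every column of $\mathbf q$ contains at least one strictly positive entry. Put $$w_{ij}=\frac{p_{ij}q_{ij}}{\sum_{n=1}^{N}p_{nj}q_{nj}},\qquad w^*_{ij}=\frac{w_{ij}}{\sum_{m=1}^{M}w_{im}} .$$ If $\mathbf q$ is connected, then each of the following systems in the unknowns $PPP_1,\dots,PPP_M$, $P_1,\dots,P_N$ (with $j=1,\dots,M$ and $i=1,\dots,N$) has a unique positive solution (up to a factor of proportionality): (a) (Rao) $PPP_j=\prod_{n=1}^{N}\left(\frac{p_{nj}}{P_n}\right)^{w_{nj}}$, $\ P_i=\prod_{m=1}^{M}\left(\frac{p_{im}}{PPP_m}\right)^{w^*_{im}}$; (b) (IDB) $\frac{1}{PPP_j}=\sum_{n=1}^{N}w_{nj}\frac{P_n}{p_{nj}}$, $\ \frac1{P_i}=\sum_{m=1}^{M}w^*_{im}\frac{PPP_m}{p_{im}}$; (c) (arithmetic) $PPP_j=\sum_{n=1}^{N}w_{nj}\frac{p_{nj}}{P_n}$, $\ P_i=\sum_{m=1}^{M}w^*_{im}\frac{p_{im}}{PPP_m}$; (d) (generalized mean of order $\rho$, for any real $\rho\neq0$) $PPP_j=\left\{\sum_{n=1}^{N}w_{nj}\left(\frac{p_{nj}}{P_n}\right)^{\rho}\right\}^{1/\rho}$, $\ P_i=\left\{\sum_{m=1}^{M}w^*_{im}\left(\frac{p_{im}}{PPP_m}\ri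ght)^{\rho}\right\}^{1/\rho}$.
   Context: Connectedness of $\mathbf q$: for every nonempty proper subset $J\subset\{1,\dots,M\}$ there exist $j\in J$, $l\in\{1,\dots,M\}\setminus J$ and $k\in\{1,\dots,N\}$ such that $q_{kj}>0$ and $q_{kl}>0$. Unique up to a factor of proportionality: a positive solution exists, and any two positive solutions $(\mathbf{PPP},\mathbf P)$, $(\mathbf{PPP}',\mathbf P')$ satisfy $\mathbf{PPP}'=\gamma\,\mathbf{PPP}$ and $\mathbf P'=\gamma^{-1}\mathbf P$ for some $\gamma>0$. *)

theory Defs
  imports "HOL-Analysis.Analysis"
begin

text \<open>
  An \<open>N \<times> M\<close> matrix is an element of \<open>real^'m^'n\<close>: rows are indexed by \<open>'n\<close>
  (\<open>N = CARD('n)\<close>), columns by \<open>'m\<close> (\<open>M = CARD('m)\<close>). In all the systems below \<open>X\<close> is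
  the vector \<open>PPP\<close> and \<open>Y\<close> is the vector \<open>P\<close>.
\<close>

definition connected_matrix :: "real^'m^'n \<Rightarrow> bool" where
  "connected_matrix q \<longleftrightarrow>
     (\<forall>J :: 'm set. J \<noteq> {} \<and> J \<noteq> UNIV \<longrightarrow>
        (\<exists>j\<in>J. \<exists>l\<in>UNIV - J. \<exists>k :: 'n. q $ k $ j > 0 \<and> q $ k $ l > 0))"

definition weight :: "real^'m^'n \<Rightarrow> real^'m^'n \<Rightarrow> real^'m^'n" where
  "weight p q = (\<chi> i j. p $ i $ j * q $ i $ j / (\<Sum>n\<in>UNIV. p $ n $ j * q $ n $ j))"

definition weight_star :: "real^'m^'n \<Rightarrow> real^'m^'n \<Rightarrow> real^'m^'n" where
  "weight_star p q = (\<chi> i j. weight p q $ i $ j / (\<Sum>m\<in>UNIV. weight p q $ i $ m))"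

text \<open>
  The powers are \<open>powr\<close>; on positive \<open>X\<close> and \<open>Y\<close>, the only case in which the systems are
  used, all bases are positive and \<open>powr\<close> is the usual real power (with value \<open>1\<close> at
  exponent \<open>0\<close>).
\<close>

definition rao_system ::
    "real^'m^'n \<Rightarrow> real^'m^'n \<Rightarrow> real^'m \<Rightarrow> real^'n \<Rightarrow> bool" where
  "rao_system p q X Y \<longleftrightarrow>
     (\<forall>j. X $ j = (\<Prod>n\<in>UNIV. (p $ n $ j / Y $ n) powr (weight p q $ n $ j))) \<and>
     (\<forall>i. Y $ i = (\<Prod>m\<in>UNIV. (p $ i $ m / X $ m) powr (weight_star p q $ i $ m)))"

definition idb_system ::
    "real^'m^'n \<Rightarrow> real^'m^'n \<Rightarrow> real^'m \<Rightarrow> real^'n \<Rightarrow> bool" where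
  "idb_system p q X Y \<longleftrightarrow>
     (\<forall>j. 1 / X $ j = (\<Sum>n\<in>UNIV. weight p q $ n $ j * (Y $ n / p $ n $ j))) \<and>
     (\<forall>i. 1 / Y $ i = (\<Sum>m\<in>UNIV. weight_star p q $ i $ m * (X $ m / p $ i $ m)))"

definition arithmetic_system ::
    "real^'m^'n \<Rightarrow> real^'m^'n \<Rightarrow> real^'m \<Rightarrow> real^'n \<Rightarrow> bool" where
  "arithmetic_system p q X Y \<longleftrightarrow>
     (\<forall>j. X $ j = (\<Sum>n\<in>UNIV. weight p q $ n $ j * (p $ n $ j / Y $ n))) \<and>
     (\<forall>i. Y $ i = (\<Sum>m\<in>UNIV. weight_star p q $ i $ m * (p $ i $ m / X $ m)))"

definition generalized_mean_system ::
    "real \<Rightarrow> real^'m^'n \<Rightarrow> real^'m^'n \<Rightarrow> real^'m \<Rightarrow> real^'n \<Rightarrow> bool" where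
  "generalized_mean_system \<rho> p q X Y \<longleftrightarrow>
     (\<forall>j. X $ j =
        (\<Sum>n\<in>UNIV. weight p q $ n $ j * (p $ n $ j / Y $ n) powr \<rho>) powr (1 / \<rho>)) \<and>
     (\<forall>i. Y $ i =
        (\<Sum>m\<in>UNIV. weight_star p q $ i $ m * (p $ i $ m / X $ m) powr \<rho>) powr (1 / \<rho>))"

definition positive_solution ::
    "(real^'m \<Rightarrow> real^'n \<Rightarrow> bool) \<Rightarrow> real^'m \<Rightarrow> real^'n \<Rightarrow> bool" where
  "positive_solution S X Y \<longleftrightarrow> (\<forall>j. X $ j > 0) \<and> (\<forall>i. Y $ i > 0) \<and> S X Y"

text \<open>The factor acts on the two blocks of unknowns inversely.\<close>

definition unique_positive_solution_up_to_factor ::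
    "(real^'m \<Rightarrow> real^'n \<Rightarrow> bool) \<Rightarrow> bool" where
  "unique_positive_solution_up_to_factor S \<longleftrightarrow>
     (\<exists>X Y. positive_solution S X Y) \<and>
     (\<forall>X Y X' Y'. positive_solution S X Y \<and> positive_solution S X' Y' \<longrightarrow>
        (\<exists>\<gamma>>0. X' = \<gamma> *\<^sub>R X \<and> Y' = inverse \<gamma> *\<^sub>R Y))"

end

theory Submission
  imports Defs
begin

text \<open>
  In the logarithmic variables \<open>\<xi> = ln PPP\<close>, \<open>\<eta> = ln P\<close>, and with
  \<open>z\<^sub>i\<^sub>j = ln p\<^sub>i\<^sub>j - \<xi>\<^sub>j - \<eta>\<^sub>i\<close>, each of the systems says that
  \<open>\<Sum>\<^sub>i w\<^sub>i\<^sub>j h(z\<^sub>i\<^sub>j) = 0\<close> for all \<open>j\<close> and \<open>\<Sum>\<^sub>j w\<^sub>i\<^sub>j h(z\<^sub>i\<^sub>j) = 0\<close> for all \<open>i\<close>, where \<open>h\<close> is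
  strictly increasing: \<open>h(z) = (e\<^bsup>\<rho>z\<^esup> - 1) / \<rho>\<close> for the mean of order \<open>\<rho>\<close>, and \<open>h(z) = z\<close>
  for the system of Rao. These are the critical point equations of the convex function
  \<open>\<Sum> w\<^sub>i\<^sub>j \<Phi>(z\<^sub>i\<^sub>j)\<close> with \<open>\<Phi>' = h\<close>. Connectedness makes this function coercive modulo the shifts
  \<open>(\<xi> + c, \<eta> - c)\<close>, hence a minimum exists; strict monotonicity of \<open>h\<close> together with
  connectedness gives uniqueness modulo these shifts.
\<close>

text \<open>If the columns satisfying \<open>P\<close> formed a proper subset, connectedness would
  give a row joining a column inside to one outside, and the step would carry \<open>P\<close>
  across.\<close>

lemma connected_matrix_induct:
  fixes w :: "real^'m^'n"
  assumes "connected_matrix w" and "P j0"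
    and "\<And>i j l. w $ i $ j > 0 \<Longrightarrow> w $ i $ l > 0 \<Longrightarrow> P j \<Longrightarrow> P l"
  shows "P l"
proof (rule ccontr)
  assume "\<not> P l"
  then have "{j. P j} \<noteq> {} \<and> {j. P j} \<noteq> UNIV"
    using assms(2) by auto
  then obtain j l k where "j \<in> {j. P j}" "l \<in> UNIV - {j. P j}" "w $ k $ j > 0" "w $ k $ l > 0"
    using assms(1) unfolding connected_matrix_def by meson
  then show False
    using assms(3) by blast
qed

section \<open>Balanced potentials\<close>

text \<open>Both families carry the same weights \<open>w\<close>, which makes them the partial
  derivatives of a single function. \<open>c\<close> will hold the logarithms of the prices.\<close>

definition balanced :: "(real \<Rightarrow> real) \<Rightarrow> real^'m^'n \<Rightarrow> real^'m^'n \<Rightarrow> real^'m \<Rightarrow> real^'n \<Rightarrow> bool" where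
  "balanced h w c x y \<longleftrightarrow>
     (\<forall>j. (\<Sum>i\<in>UNIV. w $ i $ j * h (c $ i $ j - x $ j - y $ i)) = 0) \<and>
     (\<forall>i. (\<Sum>j\<in>UNIV. w $ i $ j * h (c $ i $ j - x $ j - y $ i)) = 0)"

section \<open>Uniqueness of balanced potentials up to a shift\<close>

text \<open>Monotonicity method: the difference of the two systems is tested against
  \<open>z - z'\<close>. The total is zero although every term is nonnegative, so
  \<open>z = z'\<close> wherever \<open>w > 0\<close>.\<close>

lemma balanced_unique:
  fixes w c :: "real^'m^'n"
  assumes h: "strict_mono h"
    and w: "\<forall>i j. w $ i $ j \<ge> 0" and rows: "\<forall>i. \<exists>j. w $ i $ j > 0"
    and conn: "connected_matrix w"
    and bal: "balanced h w c x y" "balanced h w c x' y'"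
  shows "\<exists>d. (\<forall>j. x' $ j = x $ j + d) \<and> (\<forall>i. y' $ i = y $ i - d)"
proof -
  define z where "z i j = c $ i $ j - x $ j - y $ i" for i j
  define z' where "z' i j = c $ i $ j - x' $ j - y' $ i" for i j
  define D where "D i j = w $ i $ j * (h (z i j) - h (z' i j))" for i j
  have col: "(\<Sum>i\<in>UNIV. D i j) = 0" for j
    using bal unfolding balanced_def D_def z_def z'_def
    by (simp add: right_diff_distrib sum_subtractf)
  have row: "(\<Sum>j\<in>UNIV. D i j) = 0" for i
    using bal unfolding balanced_def D_def z_def z'_def
    by (simp add: right_diff_distrib sum_subtractf)
  \<comment> \<open>\<open>z - z'\<close> is a function of the column plus a function of the row;
    the vanishing column and row sums of \<open>D\<close> kill one part each.\<close>
  have "(\<Sum>i\<in>UNIV. \<Sum>j\<in>UNIV. D i j * (z i j - z' i j)) =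
      (\<Sum>i\<in>UNIV. \<Sum>j\<in>UNIV. D i j * (x' $ j - x $ j)) +
      (\<Sum>i\<in>UNIV. \<Sum>j\<in>UNIV. D i j * (y' $ i - y $ i))"
    by (simp add: z_def z'_def algebra_simps flip: sum.distrib)
  also have "(\<Sum>i\<in>UNIV. \<Sum>j\<in>UNIV. D i j * (x' $ j - x $ j)) = 0"
    by (subst sum.swap) (simp add: col flip: sum_distrib_right)
  also have "(\<Sum>i\<in>UNIV. \<Sum>j\<in>UNIV. D i j * (y' $ i - y $ i)) = 0"
    by (simp add: row flip: sum_distrib_right)
  finally have total: "(\<Sum>i\<in>UNIV. \<Sum>j\<in>UNIV. D i j * (z i j - z' i j)) = 0"
    by simp
  have nonneg: "D i j * (z i j - z' i j) \<ge> 0" for i j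
  proof -
    have "(h (z i j) - h (z' i j)) * (z i j - z' i j) \<ge> 0"
      using strict_mono_less_eq[OF h, of "z i j" "z' i j"]
        strict_mono_less_eq[OF h, of "z' i j" "z i j"]
      by (simp add: zero_le_mult_iff) linarith
    then show ?thesis
      using w unfolding D_def by (simp add: mult.assoc)
  qed
  have zero: "D i j * (z i j - z' i j) = 0" for i j
    using total nonneg by (simp add: sum_nonneg_eq_0_iff sum_nonneg)
  have edge: "x' $ j - x $ j = y $ i - y' $ i" if "w $ i $ j > 0" for i j
  proof -
    have "h (z i j) = h (z' i j) \<or> z i j = z' i j"
      using zero[of i j] that by (auto simp: D_def)
    then have "z i j = z' i j"
      using strict_mono_eq[OF h] by blast
    then show ?thesis
      by (simp add: z_def z'_def)
  qed
  \<comment> \<open>The shift is read off at an arbitrary column. Two positive entries in one row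
    force equal shifts in their columns, so connectedness spreads \<open>d\<close> to all
    columns.\<close>
  fix j0 :: 'm
  define d where "d = x' $ j0 - x $ j0"
  have xd: "x' $ l - x $ l = d" for l
  proof (rule connected_matrix_induct[OF conn, where P = "\<lambda>l. x' $ l - x $ l = d"])
    show "x' $ j0 - x $ j0 = d"
      by (simp add: d_def)
  qed (metis edge)
  have yd: "y $ i - y' $ i = d" for i
    using rows edge xd by metis
  have "x' $ j = x $ j + d" "y' $ i = y $ i - d" for i j
    using xd[of j] yd[of i] by linarith+
  then show ?thesis by blast
qed

section \<open>Existence of balanced potentials by minimisation\<close>

text \<open>Passing from one column to another through a common row changes \<open>x\<close> by at
  most \<open>2 * K\<close>, since the row value cancels. The normalisation at \<open>j0\<close>
  starts this propagation and excludes the shifts.\<close>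

lemma edge_bounded_imp_bounded:
  fixes w :: "real^'m^'n"
  assumes rows: "\<forall>i. \<exists>j. w $ i $ j > 0" and conn: "connected_matrix w"
  shows "bounded {(x :: real^'m, y :: real^'n).
    x $ j0 = 0 \<and> (\<forall>i j. w $ i $ j > 0 \<longrightarrow> \<bar>x $ j + y $ i\<bar> \<le> K)}" (is "bounded ?S")
proof -
  have "\<exists>C. \<forall>(x, y)\<in>?S. \<bar>x $ l\<bar> \<le> C" for l
  proof (rule connected_matrix_induct[OF conn,
        where P = "\<lambda>l. \<exists>C. \<forall>(x, y)\<in>?S. \<bar>x $ l\<bar> \<le> C"])
    show "\<exists>C. \<forall>(x, y)\<in>?S. \<bar>x $ j0\<bar> \<le> C"
      by (intro exI[of _ 0]) auto
  next
    fix i j l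
    assume e: "w $ i $ j > 0" "w $ i $ l > 0" and "\<exists>C. \<forall>(x, y)\<in>?S. \<bar>x $ j\<bar> \<le> C"
    then obtain C where C: "\<forall>(x, y)\<in>?S. \<bar>x $ j\<bar> \<le> C"
      by blast
    have "\<bar>x $ l\<bar> \<le> C + 2 * K" if "(x, y) \<in> ?S" for x y
    proof -
      have "\<bar>x $ j\<bar> \<le> C" "\<bar>x $ j + y $ i\<bar> \<le> K" "\<bar>x $ l + y $ i\<bar> \<le> K"
        using C e that by auto
      then show ?thesis by linarith
    qed
    then show "\<exists>C. \<forall>(x, y)\<in>?S. \<bar>x $ l\<bar> \<le> C"
      by blast
  qed
  then obtain C where C: "\<And>l x y. (x, y) \<in> ?S \<Longrightarrow> \<bar>x $ l\<bar> \<le> C l"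
    by (metis (no_types, lifting) case_prodD)
  have "\<exists>D. \<forall>(x, y)\<in>?S. \<bar>y $ i\<bar> \<le> D" for i
  proof -
    obtain j where "w $ i $ j > 0"
      using rows by blast
    have "\<bar>y $ i\<bar> \<le> C j + K" if "(x, y) \<in> ?S" for x y
    proof -
      have "\<bar>x $ j\<bar> \<le> C j" "\<bar>x $ j + y $ i\<bar> \<le> K"
        using C[OF that] \<open>w $ i $ j > 0\<close> that by auto
      then show ?thesis by linarith
    qed
    then show ?thesis by blast
  qed
  then obtain D where D: "\<And>i x y. (x, y) \<in> ?S \<Longrightarrow> \<bar>y $ i\<bar> \<le> D i"
    by (metis (no_types, lifting) case_prodD)
  have "norm v \<le> sum C UNIV + sum D UNIV" if "v \<in> ?S" for v
  proof -
    obtain x y where v: "v = (x, y)"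
      by (cases v)
    with that have xy: "(x, y) \<in> ?S"
      by blast
    have "norm x \<le> sum C UNIV"
      using norm_le_l1_cart[of x] sum_mono[of UNIV "\<lambda>l. \<bar>x $ l\<bar>" C] C[OF xy] by fastforce
    moreover have "norm y \<le> sum D UNIV"
      using norm_le_l1_cart[of y] sum_mono[of UNIV "\<lambda>l. \<bar>y $ l\<bar>" D] D[OF xy] by fastforce
    ultimately show ?thesis
      unfolding v using norm_Pair_le[of x y] by linarith
  qed
  then show ?thesis
    by (meson boundedI)
qed

text \<open>Minimise \<open>F\<close> on the slice \<open>x $ j0 = 0\<close>, where its sublevel set
  is compact. Shift invariance makes the minimum global, and its partial derivatives give the
  balance equations.\<close>

lemma balanced_exists:
  fixes w c :: "real^'m^'n"
  assumes deriv: "\<And>z. (\<Phi> has_real_derivative h z) (at z)"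
    and nonneg: "\<And>z. \<Phi> z \<ge> 0"
    and coercive: "\<And>C. \<exists>K. \<forall>z. \<Phi> z \<le> C \<longrightarrow> \<bar>z\<bar> \<le> K"
    and w: "\<forall>i j. w $ i $ j \<ge> 0" and rows: "\<forall>i. \<exists>j. w $ i $ j > 0"
    and conn: "connected_matrix w"
  shows "\<exists>x y. balanced h w c x y"
proof -
  define F :: "real^'m \<Rightarrow> real^'n \<Rightarrow> real" where
    "F x y = (\<Sum>i\<in>UNIV. \<Sum>j\<in>UNIV. w $ i $ j * \<Phi> (c $ i $ j - x $ j - y $ i))" for x y
  have cont\<Phi>: "continuous_on UNIV \<Phi>"
    using deriv by (intro DERIV_continuous_on) (auto intro: has_field_derivative_at_within)
  have contF: "continuous_on S (\<lambda>v. F (fst v) (snd v))" for S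
    unfolding F_def
    by (intro continuous_intros continuous_on_compose2[OF cont\<Phi>]) auto
  fix j0 :: 'm
  define S where "S = {v. fst v $ j0 = 0 \<and> F (fst v) (snd v) \<le> F 0 0}"
  have "\<exists>K. \<forall>v\<in>S. \<forall>i j. w $ i $ j > 0 \<longrightarrow> \<bar>fst v $ j + snd v $ i\<bar> \<le> K"
  proof -
    have "\<exists>K. \<forall>v\<in>S. w $ i $ j > 0 \<longrightarrow> \<bar>fst v $ j + snd v $ i\<bar> \<le> K" for i j
    proof -
      \<comment> \<open>All terms of \<open>F\<close> are nonnegative, so on \<open>S\<close> each
        single term is at most \<open>F 0 0\<close>.\<close>
      obtain K where K: "\<And>z. \<Phi> z \<le> F 0 0 / w $ i $ j \<Longrightarrow> \<bar>z\<bar> \<le> K"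
        using coercive by blast
      have "\<bar>fst v $ j + snd v $ i\<bar> \<le> K + \<bar>c $ i $ j\<bar>" if "v \<in> S" "w $ i $ j > 0" for v
      proof -
        let ?z = "c $ i $ j - fst v $ j - snd v $ i"
        have "w $ i $ j * \<Phi> ?z \<le> (\<Sum>j\<in>UNIV. w $ i $ j * \<Phi> (c $ i $ j - fst v $ j - snd v $ i))"
          using w nonneg by (intro member_le_sum) auto
        also have "\<dots> \<le> F (fst v) (snd v)"
          unfolding F_def using w nonneg
          by (intro member_le_sum[where f = "\<lambda>i. \<Sum>j\<in>UNIV. w $ i $ j * \<Phi> (c $ i $ j - fst v $ j - snd v $ i)"])
            (auto intro: sum_nonneg)
        also have "\<dots> \<le> F 0 0"
          using that by (simp add: S_def)
        finally have "\<bar>?z\<bar> \<le> K"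
          using that by (intro K) (simp add: field_simps)
        then show ?thesis by linarith
      qed
      then show ?thesis by blast
    qed
    then obtain K where K: "\<And>i j v. v \<in> S \<Longrightarrow> w $ i $ j > 0 \<Longrightarrow> \<bar>fst v $ j + snd v $ i\<bar> \<le> K i j"
      by metis
    \<comment> \<open>The bounds are merged into one constant by summing absolute values, because
      the chosen \<open>K i j\<close> have no known sign.\<close>
    have "K i j \<le> (\<Sum>i\<in>UNIV. \<Sum>j\<in>UNIV. \<bar>K i j\<bar>)" for i j
    proof -
      have "K i j \<le> \<bar>K i j\<bar>"
        by simp
      also have "\<dots> \<le> (\<Sum>j\<in>UNIV. \<bar>K i j\<bar>)"
        by (intro member_le_sum) auto
      also have "\<dots> \<le> (\<Sum>i\<in>UNIV. \<Sum>j\<in>UNIV. \<bar>K i j\<bar>)"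
        by (intro member_le_sum[where f = "\<lambda>i. \<Sum>j\<in>UNIV. \<bar>K i j\<bar>"]) (auto intro: sum_nonneg)
      finally show ?thesis .
    qed
    then show ?thesis
      using K by (meson order_trans)
  qed
  then obtain K where K: "\<And>v i j. v \<in> S \<Longrightarrow> w $ i $ j > 0 \<Longrightarrow> \<bar>fst v $ j + snd v $ i\<bar> \<le> K"
    by blast
  have "bounded S"
    by (rule bounded_subset[OF edge_bounded_imp_bounded[OF rows conn, of j0 K]])
      (use K in \<open>auto simp: S_def\<close>)
  moreover have "closed S"
    unfolding S_def
    by (intro closed_Collect_conj closed_Collect_eq closed_Collect_le continuous_intros contF)
  ultimately have "compact S"
    by (simp add: compact_eq_bounded_closed)
  moreover have "0 \<in> S"
    by (simp add: S_def)
  ultimately obtain v where v: "v \<in> S" "\<And>u. u \<in> S \<Longrightarrow> F (fst v) (snd v) \<le> F (fst u) (snd u)"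
    using continuous_attains_inf[OF _ _ contF, of S] by blast
  define x y where "x = fst v" and "y = snd v"
  have min: "F x y \<le> F x' y'" for x' y'
  proof -
    \<comment> \<open>\<open>u\<close> is the competitor shifted back into the slice; the shift
      cancels in every \<open>x $ j + y $ i\<close>, so \<open>F\<close> keeps its value.\<close>
    define u where "u = (\<chi> j. x' $ j - x' $ j0, \<chi> i. y' $ i + x' $ j0)"
    have eq: "F x' y' = F (fst u) (snd u)"
      by (simp add: F_def u_def algebra_simps)
    show ?thesis
    proof (cases "F x' y' \<le> F 0 0")
      case True
      then have "u \<in> S"
        unfolding S_def using eq by (simp add: u_def)
      then show ?thesis
        using v(2) eq by (simp add: x_def y_def)
    next
      case False
      then show ?thesis
        using v(1) by (simp add: S_def x_def y_def)
    qed
  qed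
  have partial: "(\<Sum>i\<in>UNIV. \<Sum>j\<in>UNIV. w $ i $ j * (h (c $ i $ j - x $ j - y $ i) * - (a $ j + b $ i))) = 0"
    for a :: "real^'m" and b :: "real^'n"
  \<comment> \<open>The minimum is global, so along the line in direction \<open>(a, b)\<close> any
    radius serves, here 1.\<close>
  proof (rule DERIV_local_min[where x = 0 and d = 1])
    show "((\<lambda>t. F (x + t *\<^sub>R a) (y + t *\<^sub>R b)) has_real_derivative
      (\<Sum>i\<in>UNIV. \<Sum>j\<in>UNIV. w $ i $ j * (h (c $ i $ j - x $ j - y $ i) * - (a $ j + b $ i)))) (at 0)"
      unfolding F_def
    proof (intro DERIV_sum DERIV_cmult DERIV_chain2[where f = \<Phi>])
      fix i j
      show "(\<Phi> has_real_derivative h (c $ i $ j - x $ j - y $ i))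
          (at (c $ i $ j - (x + 0 *\<^sub>R a) $ j - (y + 0 *\<^sub>R b) $ i))"
        using deriv by simp
      show "((\<lambda>t. c $ i $ j - (x + t *\<^sub>R a) $ j - (y + t *\<^sub>R b) $ i) has_real_derivative
          - (a $ j + b $ i)) (at 0)"
        by (auto intro!: derivative_eq_intros)
    qed
  qed (use min in auto)
  have "balanced h w c x y"
    unfolding balanced_def
  proof (intro conjI allI)
    fix j
    \<comment> \<open>The direction \<open>axis j 1\<close> in the column variables isolates column
      \<open>j\<close>; below, its row analogue isolates row \<open>i\<close>.\<close>
    have "(\<Sum>k\<in>UNIV. w $ i $ k * (h (c $ i $ k - x $ k - y $ i) * - (axis j 1 $ k + 0 $ i)))
        = - (w $ i $ j * h (c $ i $ j - x $ j - y $ i))" for i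
      by (simp add: axis_def if_distrib[of "\<lambda>t. _ * (_ * t)"] if_distrib[of uminus] sum_negf cong: if_cong)
    then show "(\<Sum>i\<in>UNIV. w $ i $ j * h (c $ i $ j - x $ j - y $ i)) = 0"
      using partial[of "axis j 1" 0] by (simp add: sum_negf)
  next
    fix i
    have "(\<Sum>k\<in>UNIV. \<Sum>j\<in>UNIV. w $ k $ j * (h (c $ k $ j - x $ j - y $ k) * - (0 $ j + axis i 1 $ k)))
        = (\<Sum>j\<in>UNIV. - (w $ i $ j * h (c $ i $ j - x $ j - y $ i)))"
      by (subst sum.swap)
        (simp add: axis_def if_distrib[of "\<lambda>t. _ * (_ * t)"] if_distrib[of uminus] sum_negf cong: if_cong)
    then show "(\<Sum>j\<in>UNIV. w $ i $ j * h (c $ i $ j - x $ j - y $ i)) = 0"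
      using partial[of 0 "axis i 1"] by (simp add: sum_negf)
  qed
  then show ?thesis by blast
qed

section \<open>From potentials to positive solutions\<close>

lemma unique_solution_if_balanced:
  fixes w p :: "real^'m^'n"
  assumes system: "\<And>X Y. \<forall>j. X $ j > 0 \<Longrightarrow> \<forall>i. Y $ i > 0 \<Longrightarrow>
      S X Y \<longleftrightarrow> balanced h w (\<chi> i j. ln (p $ i $ j)) (\<chi> j. ln (X $ j)) (\<chi> i. ln (Y $ i))"
    and h: "strict_mono h"
    and deriv: "\<And>z. (\<Phi> has_real_derivative h z) (at z)"
    and nonneg: "\<And>z. \<Phi> z \<ge> 0"
    and coercive: "\<And>C. \<exists>K. \<forall>z. \<Phi> z \<le> C \<longrightarrow> \<bar>z\<bar> \<le> K"
    and w: "\<forall>i j. w $ i $ j \<ge> 0" and rows: "\<forall>i. \<exists>j. w $ i $ j > 0"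
    and conn: "connected_matrix w"
  shows "unique_positive_solution_up_to_factor S"
  unfolding unique_positive_solution_up_to_factor_def
proof (intro conjI allI impI)
  obtain x y where xy: "balanced h w (\<chi> i j. ln (p $ i $ j)) x y"
    using balanced_exists[OF deriv nonneg coercive w rows conn] by blast
  have "positive_solution S (\<chi> j. exp (x $ j)) (\<chi> i. exp (y $ i))"
    using xy by (simp add: positive_solution_def system)
  then show "\<exists>X Y. positive_solution S X Y"
    by blast
next
  fix X Y X' Y'
  assume "positive_solution S X Y \<and> positive_solution S X' Y'"
  then have pos: "\<forall>j. X $ j > 0" "\<forall>i. Y $ i > 0" "\<forall>j. X' $ j > 0" "\<forall>i. Y' $ i > 0"
    and "S X Y" "S X' Y'"
    by (auto simp: positive_solution_def)
  then have "balanced h w (\<chi> i j. ln (p $ i $ j)) (\<chi> j. ln (X $ j)) (\<chi> i. ln (Y $ i))"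
    "balanced h w (\<chi> i j. ln (p $ i $ j)) (\<chi> j. ln (X' $ j)) (\<chi> i. ln (Y' $ i))"
    using system by blast+
  from balanced_unique[OF h w rows conn this]
  obtain d where d: "\<And>j. ln (X' $ j) = ln (X $ j) + d" "\<And>i. ln (Y' $ i) = ln (Y $ i) - d"
    by auto
  \<comment> \<open>The opposite additive shifts of the logarithms become the inverse factors
    \<open>exp d\<close> and \<open>inverse (exp d)\<close>.\<close>
  have "X' $ j = exp d * X $ j" for j
    using arg_cong[OF d(1)[of j], of exp] pos by (simp add: exp_add)
  moreover have "Y' $ i = inverse (exp d) * Y $ i" for i
    using arg_cong[OF d(2)[of i], of exp] pos by (simp add: exp_diff divide_inverse_commute)
  ultimately have "X' = exp d *\<^sub>R X \<and> Y' = inverse (exp d) *\<^sub>R Y"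
    by (simp add: vec_eq_iff)
  then show "\<exists>\<gamma>>0. X' = \<gamma> *\<^sub>R X \<and> Y' = inverse \<gamma> *\<^sub>R Y"
    using exp_gt_zero by blast
qed

section \<open>Weighted means as balance equations\<close>

text \<open>After raising to the power \<open>\<rho>\<close> and dividing by
  \<open>x powr \<rho>\<close>, the constant 1 is distributed over the weights, whose sum is 1. The
  extra division by \<open>\<rho>\<close> makes the summand increasing in
  \<open>ln (b i) - ln x\<close> for either sign of \<open>\<rho>\<close>.\<close>

lemma weighted_power_mean_eq_iff:
  fixes \<omega> b :: "'a \<Rightarrow> real"
  assumes "finite A" and w: "\<And>i. i \<in> A \<Longrightarrow> \<omega> i \<ge> 0" and sum1: "sum \<omega> A = 1"
    and b: "\<And>i. i \<in> A \<Longrightarrow> b i > 0" and x: "x > 0" and \<rho>: "\<rho> \<noteq> 0"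
  shows "x = (\<Sum>i\<in>A. \<omega> i * b i powr \<rho>) powr (1 / \<rho>) \<longleftrightarrow>
    (\<Sum>i\<in>A. \<omega> i * ((exp (\<rho> * (ln (b i) - ln x)) - 1) / \<rho>)) = 0"
proof -
  let ?s = "\<Sum>i\<in>A. \<omega> i * b i powr \<rho>"
  have s: "?s \<ge> 0"
    using w by (intro sum_nonneg) auto
  have "x = ?s powr (1 / \<rho>) \<longleftrightarrow> x powr \<rho> = ?s"
  proof
    assume "x = ?s powr (1 / \<rho>)"
    then have "x powr \<rho> = (?s powr (1 / \<rho>)) powr \<rho>"
      by simp
    then show "x powr \<rho> = ?s"
      using \<rho> s by (simp add: powr_powr)
  next
    assume "x powr \<rho> = ?s"
    then have "?s powr (1 / \<rho>) = (x powr \<rho>) powr (1 / \<rho>)"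
      by simp
    then show "x = ?s powr (1 / \<rho>)"
      using \<rho> x by (simp add: powr_powr)
  qed
  also have "\<dots> \<longleftrightarrow> (\<Sum>i\<in>A. \<omega> i * ((exp (\<rho> * (ln (b i) - ln x)) - 1) / \<rho>)) = 0"
  proof -
    have "(\<Sum>i\<in>A. \<omega> i * ((exp (\<rho> * (ln (b i) - ln x)) - 1) / \<rho>)) =
        (\<Sum>i\<in>A. (\<omega> i * b i powr \<rho> / x powr \<rho> - \<omega> i) / \<rho>)"
      using b x
      by (intro sum.cong) (force simp: powr_def right_diff_distrib exp_diff diff_divide_distrib)+
    also have "\<dots> = (?s / x powr \<rho> - 1) / \<rho>"
      by (simp add: sum1 sum_subtractf flip: sum_divide_distrib)
    finally show ?thesis
      using \<rho> x by auto
  qed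
  finally show ?thesis .
qed

lemma weighted_geometric_mean_eq_iff:
  fixes \<omega> b :: "'a \<Rightarrow> real"
  assumes "finite A" and sum1: "sum \<omega> A = 1"
    and b: "\<And>i. i \<in> A \<Longrightarrow> b i > 0" and x: "x > 0"
  shows "x = (\<Prod>i\<in>A. b i powr \<omega> i) \<longleftrightarrow> (\<Sum>i\<in>A. \<omega> i * (ln (b i) - ln x)) = 0"
proof -
  have "(\<Prod>i\<in>A. b i powr \<omega> i) = exp (\<Sum>i\<in>A. \<omega> i * ln (b i))"
    using b by (force simp: exp_sum[OF \<open>finite A\<close>] powr_def intro!: prod.cong)
  then have "x = (\<Prod>i\<in>A. b i powr \<omega> i) \<longleftrightarrow> ln x = (\<Sum>i\<in>A. \<omega> i * ln (b i))"
    using x by (metis exp_ln ln_exp)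
  also have "\<dots> \<longleftrightarrow> (\<Sum>i\<in>A. \<omega> i * (ln (b i) - ln x)) = 0"
    by (auto simp: right_diff_distrib sum_subtractf sum1 simp flip: sum_distrib_right)
  finally show ?thesis .
qed

lemma unique_positive_solution_cong:
  assumes "\<And>X Y. \<forall>j. X $ j > 0 \<Longrightarrow> \<forall>i. Y $ i > 0 \<Longrightarrow> S X Y \<longleftrightarrow> S' X Y"
  shows "unique_positive_solution_up_to_factor S \<longleftrightarrow> unique_positive_solution_up_to_factor S'"
proof -
  have "positive_solution S = positive_solution S'"
    using assms by (intro ext) (auto simp: positive_solution_def)
  then show ?thesis
    by (simp add: unique_positive_solution_up_to_factor_def)
qed

section \<open>Weights and reduction of the systems to balance equations\<close>

context
  fixes p q :: "real^'m^'n"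
  assumes p_pos: "\<forall>i j. p $ i $ j > 0"
    and q_nonneg: "\<forall>i j. q $ i $ j \<ge> 0"
    and q_rows: "\<forall>i. \<exists>j. q $ i $ j > 0"
    and q_cols: "\<forall>j. \<exists>i. q $ i $ j > 0"
begin

lemma weight_denominator_pos: "(\<Sum>n\<in>UNIV. p $ n $ j * q $ n $ j) > 0"
proof -
  obtain i where "q $ i $ j > 0"
    using q_cols by blast
  then show ?thesis
    using p_pos q_nonneg by (intro sum_pos2[of UNIV i]) (auto simp: less_imp_le)
qed

lemma weight_nonneg: "weight p q $ i $ j \<ge> 0"
  using p_pos q_nonneg weight_denominator_pos[of j] by (simp add: weight_def less_imp_le)

text \<open>Through this equivalence, connectedness and the row condition pass from \<open>q\<close>
  to the weights.\<close>

lemma weight_pos_iff: "weight p q $ i $ j > 0 \<longleftrightarrow> q $ i $ j > 0"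
  using p_pos weight_denominator_pos[of j]
  by (simp add: weight_def zero_less_divide_iff zero_less_mult_iff less_not_sym)

lemma sum_weight: "(\<Sum>i\<in>UNIV. weight p q $ i $ j) = 1"
  using weight_denominator_pos[of j] by (simp add: weight_def flip: sum_divide_distrib)

lemma weight_row_pos: "(\<Sum>m\<in>UNIV. weight p q $ i $ m) > 0"
proof -
  obtain j where "q $ i $ j > 0"
    using q_rows by blast
  then show ?thesis
    using weight_nonneg weight_pos_iff by (intro sum_pos2[of UNIV j]) auto
qed

lemma weight_star_nonneg: "weight_star p q $ i $ j \<ge> 0"
  using weight_nonneg weight_row_pos[of i] by (simp add: weight_star_def less_imp_le)

lemma sum_weight_star: "(\<Sum>j\<in>UNIV. weight_star p q $ i $ j) = 1"
  using weight_row_pos[of i] by (simp add: weight_star_def flip: sum_divide_distrib)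

text \<open>The normalising factor is positive and constant along a row. This lets
  \<open>weight\<close> replace \<open>weight_star\<close> in the row equations, so that both
  families share one matrix.\<close>

lemma sum_weight_star_eq_0_iff:
  "(\<Sum>j\<in>UNIV. weight_star p q $ i $ j * f j) = 0 \<longleftrightarrow> (\<Sum>j\<in>UNIV. weight p q $ i $ j * f j) = 0"
  using weight_row_pos[of i] by (simp add: weight_star_def flip: sum_divide_distrib)

lemma generalized_mean_system_iff_balanced:
  assumes "\<rho> \<noteq> 0" and "\<forall>j. X $ j > 0" and "\<forall>i. Y $ i > 0"
  shows "generalized_mean_system \<rho> p q X Y \<longleftrightarrow>
    balanced (\<lambda>z. (exp (\<rho> * z) - 1) / \<rho>) (weight p q)
      (\<chi> i j. ln (p $ i $ j)) (\<chi> j. ln (X $ j)) (\<chi> i. ln (Y $ i))"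
proof -
  have ln: "ln (p $ i $ j / Y $ i) - ln (X $ j) = ln (p $ i $ j) - ln (X $ j) - ln (Y $ i)"
    "ln (p $ i $ j / X $ j) - ln (Y $ i) = ln (p $ i $ j) - ln (X $ j) - ln (Y $ i)" for i j
    using assms p_pos by (simp_all add: ln_div less_imp_neq[THEN not_sym])
  have col: "X $ j = (\<Sum>n\<in>UNIV. weight p q $ n $ j * (p $ n $ j / Y $ n) powr \<rho>) powr (1 / \<rho>)
      \<longleftrightarrow> (\<Sum>i\<in>UNIV. weight p q $ i $ j *
        ((exp (\<rho> * (ln (p $ i $ j) - ln (X $ j) - ln (Y $ i))) - 1) / \<rho>)) = 0" for j
    using assms p_pos
    by (subst weighted_power_mean_eq_iff) (auto simp: weight_nonneg sum_weight ln)
  have row: "Y $ i = (\<Sum>m\<in>UNIV. weight_star p q $ i $ m * (p $ i $ m / X $ m) powr \<rho>) powr (1 / \<rho>)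
      \<longleftrightarrow> (\<Sum>j\<in>UNIV. weight p q $ i $ j *
        ((exp (\<rho> * (ln (p $ i $ j) - ln (X $ j) - ln (Y $ i))) - 1) / \<rho>)) = 0" for i
    using assms p_pos
    by (subst weighted_power_mean_eq_iff)
      (auto simp: weight_star_nonneg sum_weight_star ln sum_weight_star_eq_0_iff
        simp del: times_divide_eq_right)
  show ?thesis
    unfolding generalized_mean_system_def balanced_def using col row by simp
qed

lemma rao_system_iff_balanced:
  assumes "\<forall>j. X $ j > 0" and "\<forall>i. Y $ i > 0"
  shows "rao_system p q X Y \<longleftrightarrow>
    balanced (\<lambda>z. z) (weight p q)
      (\<chi> i j. ln (p $ i $ j)) (\<chi> j. ln (X $ j)) (\<chi> i. ln (Y $ i))"
proof -
  have ln: "ln (p $ i $ j / Y $ i) - ln (X $ j) = ln (p $ i $ j) - ln (X $ j) - ln (Y $ i)"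
    "ln (p $ i $ j / X $ j) - ln (Y $ i) = ln (p $ i $ j) - ln (X $ j) - ln (Y $ i)" for i j
    using assms p_pos by (simp_all add: ln_div less_imp_neq[THEN not_sym])
  have col: "X $ j = (\<Prod>n\<in>UNIV. (p $ n $ j / Y $ n) powr (weight p q $ n $ j))
      \<longleftrightarrow> (\<Sum>i\<in>UNIV. weight p q $ i $ j * (ln (p $ i $ j) - ln (X $ j) - ln (Y $ i))) = 0" for j
    using assms p_pos
    by (subst weighted_geometric_mean_eq_iff) (auto simp: sum_weight ln)
  have row: "Y $ i = (\<Prod>m\<in>UNIV. (p $ i $ m / X $ m) powr (weight_star p q $ i $ m))
      \<longleftrightarrow> (\<Sum>j\<in>UNIV. weight p q $ i $ j * (ln (p $ i $ j) - ln (X $ j) - ln (Y $ i))) = 0" for i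
    using assms p_pos
    by (subst weighted_geometric_mean_eq_iff)
      (auto simp: sum_weight_star ln sum_weight_star_eq_0_iff)
  show ?thesis
    unfolding rao_system_def balanced_def using col row by simp
qed

lemma arithmetic_system_iff_generalized_mean:
  assumes "\<forall>j. X $ j > 0" and "\<forall>i. Y $ i > 0"
  shows "arithmetic_system p q X Y \<longleftrightarrow> generalized_mean_system 1 p q X Y"
proof -
  have "p $ i $ j / Y $ i \<ge> 0" "p $ i $ j / X $ j \<ge> 0" for i j
    using assms p_pos by (simp_all add: less_imp_le)
  then show ?thesis
    unfolding arithmetic_system_def generalized_mean_system_def
    by (simp add: sum_nonneg weight_nonneg weight_star_nonneg del: times_divide_eq_right abs_divide)
qed

lemma idb_system_iff_generalized_mean:
  assumes "\<forall>j. X $ j > 0" and "\<forall>i. Y $ i > 0"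
  shows "idb_system p q X Y \<longleftrightarrow> generalized_mean_system (-1) p q X Y"
proof -
  have inv: "1 / \<bar>p $ i $ j / Y $ i\<bar> = Y $ i / p $ i $ j"
    "1 / \<bar>p $ i $ j / X $ j\<bar> = X $ j / p $ i $ j"
    "Y $ i / p $ i $ j \<ge> 0" "X $ j / p $ i $ j \<ge> 0" for i j
    using assms p_pos by (simp_all add: less_imp_le)
  \<comment> \<open>The case \<open>s = 0\<close> relies on the conventions \<open>1 / 0 = 0\<close>
    and \<open>0 powr -1 = 0\<close>: both sides then say \<open>x = 0\<close>.\<close>
  have flip: "1 / x = s \<longleftrightarrow> x = s powr -1" if "s \<ge> 0" for x s :: real
    using that by (auto simp: powr_minus divide_inverse)
  show ?thesis
    unfolding idb_system_def generalized_mean_system_def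
    by (simp add: inv flip sum_nonneg weight_nonneg weight_star_nonneg
        del: times_divide_eq_right abs_divide)
qed

end

section \<open>Choice of \<open>h\<close> and its antiderivative for the four systems\<close>

theorem corollary3:
  fixes p q :: "real^'m^'n"
  assumes p_pos: "\<forall>i j. p $ i $ j > 0"
    and q_nonneg: "\<forall>i j. q $ i $ j \<ge> 0"
    and q_rows: "\<forall>i. \<exists>j. q $ i $ j > 0"
    and q_cols: "\<forall>j. \<exists>i. q $ i $ j > 0"
    and q_connected: "connected_matrix q"
  shows "unique_positive_solution_up_to_factor (rao_system p q) \<and>
    unique_positive_solution_up_to_factor (idb_system p q) \<and>
    unique_positive_solution_up_to_factor (arithmetic_system p q) \<and>
    (\<forall>\<rho>. \<rho> \<noteq> 0 \<longrightarrow> unique_positive_solution_up_to_factor (generalized_mean_system \<rho> p q))"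
proof -
  note pq = p_pos q_nonneg q_rows q_cols
  have w: "\<forall>i j. weight p q $ i $ j \<ge> 0" and rows: "\<forall>i. \<exists>j. weight p q $ i $ j > 0"
    and conn: "connected_matrix (weight p q)"
    using weight_nonneg[OF pq] q_rows q_connected
    by (auto simp: weight_pos_iff[OF pq] connected_matrix_def)
  have gm: "unique_positive_solution_up_to_factor (generalized_mean_system \<rho> p q)"
    if \<rho>: "\<rho> \<noteq> 0" for \<rho>
  \<comment> \<open>This \<Phi> is the antiderivative of \<open>h\<close> vanishing at 0; it is
    nonnegative because \<open>exp t \<ge> 1 + t\<close>.\<close>
  proof (rule unique_solution_if_balanced[OF generalized_mean_system_iff_balanced[OF pq \<rho>]
        _ _ _ _ w rows conn, where \<Phi> = "\<lambda>z. (exp (\<rho> * z) - 1 - \<rho> * z) / \<rho>\<^sup>2"])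
    show "strict_mono (\<lambda>z. (exp (\<rho> * z) - 1) / \<rho>)"
      using \<rho> by (cases "\<rho> > 0") (auto simp: strict_mono_def divide_simps)
    show "((\<lambda>z. (exp (\<rho> * z) - 1 - \<rho> * z) / \<rho>\<^sup>2) has_real_derivative (exp (\<rho> * z) - 1) / \<rho>) (at z)" for z
      using \<rho> by (auto intro!: derivative_eq_intros simp: field_simps power2_eq_square)
    show "(exp (\<rho> * z) - 1 - \<rho> * z) / \<rho>\<^sup>2 \<ge> 0" for z
      using exp_ge_add_one_self[of "\<rho> * z"]
      by (intro divide_nonneg_nonneg) (linarith, simp)
    show "\<exists>K. \<forall>z. (exp (\<rho> * z) - 1 - \<rho> * z) / \<rho>\<^sup>2 \<le> C \<longrightarrow> \<bar>z\<bar> \<le> K" for C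
    proof (intro exI allI impI)
      fix z assume "(exp (\<rho> * z) - 1 - \<rho> * z) / \<rho>\<^sup>2 \<le> C"
      then have le: "exp (\<rho> * z) - 1 - \<rho> * z \<le> C * \<rho>\<^sup>2"
        using \<rho> by (simp add: divide_simps)
      \<comment> \<open>Linear growth on both sides gives coercivity: the quadratic Taylor bound for
        \<open>y \<ge> 0\<close>, and the term \<open>- y\<close> for \<open>y < 0\<close>.\<close>
      have lower: "\<bar>y\<bar> - 1 \<le> exp y - 1 - y" for y :: real
      proof (cases "y \<ge> 0")
        case True
        then show ?thesis
          using exp_lower_Taylor_quadratic[of y] zero_le_power2[of "y - 1"]
          by (simp add: power2_eq_square algebra_simps)
      next
        case False
        then show ?thesis
          using exp_gt_zero[of y] by (simp add: less_imp_le)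
      qed
      have "\<bar>\<rho>\<bar> * \<bar>z\<bar> \<le> C * \<rho>\<^sup>2 + 1"
        using lower[of "\<rho> * z"] le by (simp add: abs_mult)
      then show "\<bar>z\<bar> \<le> (C * \<rho>\<^sup>2 + 1) / \<bar>\<rho>\<bar>"
        using \<rho> by (simp add: field_simps)
    qed
  qed
  have "unique_positive_solution_up_to_factor (rao_system p q)"
  proof (rule unique_solution_if_balanced[OF rao_system_iff_balanced[OF pq]
        _ _ _ _ w rows conn, where \<Phi> = "\<lambda>z. z\<^sup>2 / 2"])
    show "strict_mono (\<lambda>z :: real. z)"
      by (simp add: strict_mono_def)
    show "((\<lambda>z. z\<^sup>2 / 2) has_real_derivative z) (at z)" for z :: real
      by (auto intro!: derivative_eq_intros)
    show "\<exists>K. \<forall>z :: real. z\<^sup>2 / 2 \<le> C \<longrightarrow> \<bar>z\<bar> \<le> K" for C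
      by (intro exI[of _ "sqrt (2 * C)"]) (auto intro: real_le_rsqrt)
    show "z\<^sup>2 / 2 \<ge> 0" for z :: real
      by (intro divide_nonneg_pos) simp_all
  qed
  moreover have "unique_positive_solution_up_to_factor (idb_system p q)"
    by (subst unique_positive_solution_cong[OF idb_system_iff_generalized_mean[OF pq]])
      (simp_all add: gm)
  moreover have "unique_positive_solution_up_to_factor (arithmetic_system p q)"
    by (subst unique_positive_solution_cong[OF arithmetic_system_iff_generalized_mean[OF pq]])
      (simp_all add: gm)
  ultimately show ?thesis
    using gm by blast
qed

end
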